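(* Let $a>0$ and let $\mathcal{S}(x)=-\frac{x^2}{2a}+V(x)$ with $V\in x^3\mathbb{R}[[x]]$. Then $$\mathcal{F}[\mathcal{S}(x)](\hbar)=\sum_{n=0}^\infty \hbar^n\,(2n+1)!!\,[y^{2n+1}]\,x(y),$$ where $x(y)\in\mathbb{R}[[y]]$ is the unique power series solution of $y=\sqrt{-2\,\mathcal{S}(x(y))}$, with the positive branch of the square root.
   Context: For $\mathcal{S}(x)=-\frac{x^2}{2a}+V(x)$ with $a>0$ and $V\in x^3\mathbb{R}[[x]]$, the formal integral is the formal power series in $\hbar$ $$\mathcal{F}[\mathcal{S}(x)](\hbar)=\sqrt{a}\sum_{n=0}^\infty (a\hbar)^n(2n-1)!!\,[x^{2n}]e^{\frac1\hbar V(x)},$$ with $(-1)!!=1$; it is well defined because $[x^{2n}]e^{V(x)/\hbar}$ is a polynomial in $\hbar^{-1}$ of degree smaller than $n$ for $n\geq 1$. The positive branch of $\sqrt{-2\mathcal{S}(x)}$ is the formal power series $\frac{x}{\sqrt a}\big(1-2aV(x)/x^2\big)^{1/2}=\frac{x}{\sqrt a}+\cdots$, so $x(y)=\sqrt a\,y+\cdots$ is its compositional inverse. *)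

theory Defs
  imports Complex_Main "HOL-Computational_Algebra.Computational_Algebra"
begin

unbundle fps_syntax

fun double_fact :: "nat \<Rightarrow> nat" where
  "double_fact 0 = 1"
| "double_fact (Suc 0) = 1"
| "double_fact (Suc (Suc n)) = Suc (Suc n) * double_fact n"

(* An action S(x) = - x^2/(2a) + V(x) determines a and V; these recover them, see
   quad_param_action and interaction_action below. *)

definition quad_param :: "real fps \<Rightarrow> real" where
  "quad_param S = - 1 / (2 * S $ 2)"

definition interaction :: "real fps \<Rightarrow> real fps" where
  "interaction S = S + fps_const (1 / (2 * quad_param S)) * fps_X ^ 2"

(* exp(V(x)/hbar) as a power series in x over the field of Laurent series in hbar, where
   hbar = fls_X. The composition is meaningful only for V $ 0 = 0. *)
definition exp_over_hbar :: "real fps \<Rightarrow> real fls fps" where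
  "exp_over_hbar V = fps_exp 1 oo (fps_const fls_X_inv * Abs_fps (\<lambda>n. fls_const (V $ n)))"

(* The sum over n is taken in the topology of formal Laurent series in hbar. For n = 0 the
   truncated subtraction gives double_fact 0 = 1, the convention (-1)!! = 1. *)
definition formal_integral :: "real fps \<Rightarrow> real fls" where
  "formal_integral S =
     (let a = quad_param S; V = interaction S in
      fls_const (sqrt a) *
        (\<Sum>n. (fls_const a * fls_X) ^ n * of_nat (double_fact (2 * n - 1)) *
             exp_over_hbar V $ (2 * n)))"

(* The positive branch of the square root of -2 S(x),
   that is (x / sqrt a) * (1 - 2 a V(x) / x^2)^(1/2). *)
definition pos_sqrt_action :: "real fps \<Rightarrow> real fps" where
  "pos_sqrt_action S =
     (let a = quad_param S; V = interaction S in
      fps_const (1 / sqrt a) * fps_X *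
        fps_radical root 2 (1 - fps_const (2 * a) * (V / fps_X ^ 2)))"

lemma nth_zero_if_X_power_dvd:
  fixes V :: "real fps"
  assumes "fps_X ^ k dvd V" "i < k"
  shows "V $ i = 0"
  using assms by (auto simp: dvd_def fps_X_power_mult_nth)

lemma quad_param_action:
  fixes V :: "real fps"
  assumes "a > 0" "fps_X ^ 3 dvd V"
  shows "quad_param (- fps_const (1 / (2 * a)) * fps_X ^ 2 + V) = a"
  using assms nth_zero_if_X_power_dvd[of 3 V 2]
  by (simp add: quad_param_def fps_X_power_nth field_simps)

lemma interaction_action:
  fixes V :: "real fps"
  assumes "a > 0" "fps_X ^ 3 dvd V"
  shows "interaction (- fps_const (1 / (2 * a)) * fps_X ^ 2 + V) = V"
  unfolding interaction_def quad_param_action[OF assms] by (simp add: algebra_simps)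

lemma exp_over_hbar_nth:
  "exp_over_hbar V $ m = (\<Sum>k=0..m. fls_const ((V ^ k) $ m / fact k) * fls_X_inv ^ k)"
proof -
  define W where "W = Abs_fps (\<lambda>n. fls_const (V $ n))"
  have W: "(W ^ k) $ i = fls_const ((V ^ k) $ i)" for k i
  proof (induction k arbitrary: i)
    case 0
    show ?case by simp
  next
    case (Suc k)
    have "fls_const (sum f A) = (\<Sum>j\<in>A. fls_const (f j))" for f :: "nat \<Rightarrow> real" and A
      by (induction A rule: infinite_finite_induct) (auto simp flip: fls_plus_const)
    then show ?case
      by (simp add: fps_mult_nth Suc) (simp add: W_def)
  qed
  have fact: "(1 :: real fls) / of_nat (fact k) = fls_const (1 / fact k)" for k
    by (simp add: fls_of_nat fls_inverse_const divide_inverse del: of_nat_fact)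
       (simp add: fls_const_mult_const)
  have "fps_exp 1 $ k * ((fps_const fls_X_inv * W) ^ k) $ m =
        fls_const ((V ^ k) $ m / fact k) * fls_X_inv ^ k" for k
    using fact[of k]
    by (simp add: power_mult_distrib fps_const_power W fps_exp_def
             del: of_nat_fact flip: fls_const_mult_const)
       (simp add: fls_const_mult_const mult_ac)
  then show ?thesis
    by (simp add: exp_over_hbar_def fps_compose_nth flip: W_def)
qed

lemma pos_sqrt_action:
  fixes V :: "real fps"
  assumes "a > 0" "fps_X ^ 3 dvd V"
  defines "S \<equiv> - fps_const (1 / (2 * a)) * fps_X ^ 2 + V"
  shows "pos_sqrt_action S ^ 2 = - 2 * S" "pos_sqrt_action S $ 1 > 0"
proof -
  obtain U where V: "V = fps_X ^ 3 * U"
    using assms(2) by (auto simp: dvd_def)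
  define R where "R = 1 - fps_const (2 * a) * (V / fps_X ^ 2)"
  have V2: "V / fps_X ^ 2 = fps_X * U"
  proof -
    have "V = (fps_X * U) * fps_X ^ 2"
      by (simp add: V power3_eq_cube power2_eq_square mult_ac)
    then show ?thesis
      by (simp only: nonzero_mult_div_cancel_right fps_X_neq_zero power_not_zero not_False_eq_True)
  qed
  have "R $ 0 = 1"
    unfolding R_def V2 by simp
  then have "fps_radical root 2 R ^ 2 = R"
    using power_radical[of R root 1] by (simp add: numeral_2_eq_2)
  moreover have S: "pos_sqrt_action S = fps_const (1 / sqrt a) * fps_X * fps_radical root 2 R"
    using quad_param_action[OF assms(1,2)] interaction_action[OF assms(1,2)]
    by (simp add: pos_sqrt_action_def R_def S_def)
  ultimately have "pos_sqrt_action S ^ 2 = fps_const (1 / a) * fps_X ^ 2 * R"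
    using assms(1) by (simp add: power_mult_distrib fps_const_power power_divide)
  also have "\<dots> = fps_const (1 / a) * fps_X ^ 2 - fps_const (1 / a * (2 * a)) * fps_X ^ 3 * U"
    unfolding R_def V2 fps_const_mult[symmetric]
    by (simp add: algebra_simps power2_eq_square power3_eq_cube del: fps_const_mult)
  also have "\<dots> = - 2 * S"
  proof -
    have "- 2 * S = 2 * fps_const (1 / (2 * a)) * fps_X ^ 2 - 2 * fps_X ^ 3 * U"
      unfolding S_def V by algebra
    also have "2 * fps_const (1 / (2 * a)) = fps_const (1 / a)"
      by (simp add: numeral_fps_const)
    finally show ?thesis
      using assms(1) by (simp add: numeral_fps_const)
  qed
  finally show "pos_sqrt_action S ^ 2 = - 2 * S" .
  show "pos_sqrt_action S $ 1 > 0"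
    using \<open>R $ 0 = 1\<close> assms(1) by (simp add: S mult.assoc)
qed

end

(* By Lagrange inversion (the residue of y^(-2m-1) dx), (2m+1) [y^(2m+1)] x(y) is the coefficient
   of x^(2m) in (x/y)^(2m+1) = a^(m + 1/2) (1 - 2 a V / x^2)^(- m - 1/2). Expanding this binomially,
   its k-th term multiplied by (2m-1)!! is the term n = m + k of the formal integral at hbar^m,
   because (-2)^k k! binom(-m - 1/2, k) = (2m+1) (2m+3) ... (2m+2k-1). The sum is finite since V^k
   has order at least 3k, which forces k <= 2m. *)

theory Submission
  imports Defs
begin

section \<open>Residues and Lagrange inversion\<close>

text \<open>Up to the factor -(j-1), which characteristic 0 allows to cancel, F' F^(-j) is the
  derivative of F^(1-j), and a derivative has residue 0.\<close>

lemma fls_residue_deriv_times_inverse_power: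
  fixes F :: "'a :: field_char_0 fls"
  assumes "F \<noteq> 0" "j \<ge> 2"
  shows "fls_residue (fls_deriv F * inverse F ^ j) = 0"
proof -
  define H where "H = inverse F"
  have FH: "F * H = 1"
    using assms(1) by (simp add: H_def)
  have "fls_deriv (F * H) = 0"
    by (simp only: FH fls_deriv_one)
  then have "F * fls_deriv H = - (fls_deriv F * H)"
    by (simp add: eq_neg_iff_add_eq_0 add.commute)
  then have "H * (F * fls_deriv H) = - (fls_deriv F * H ^ 2)"
    by (simp add: power2_eq_square)
  then have H': "fls_deriv H = - (fls_deriv F * H ^ 2)"
    using FH by (metis mult.assoc mult.commute mult_1)
  obtain i where j: "j = Suc (Suc i)"
    using assms(2) by (metis add_2_eq_Suc le_Suc_ex)
  have "fls_deriv (H ^ Suc i) = of_nat (Suc i) * (fls_deriv H * H ^ i)"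
    by (subst fls_deriv_power) (simp add: mult_ac)
  also have "\<dots> = - of_nat (Suc i) * (fls_deriv F * H ^ j)"
    unfolding H' j by (simp add: power2_eq_square algebra_simps)
  finally have "fls_residue (- of_nat (Suc i) * (fls_deriv F * H ^ j)) = 0"
    by (metis fls_residue_deriv)
  then have "of_int (- int (Suc i)) * fls_residue (fls_deriv F * H ^ j) = 0"
    by (metis fls_residue_of_int_times(1) of_int_minus of_int_of_nat_eq)
  then show ?thesis
    unfolding H_def of_int_minus of_int_of_nat_eq mult_eq_0_iff neg_equal_0_iff_equal of_nat_eq_0_iff
    by simp
qed

text \<open>Let f = X g. Differentiating x(f) = X gives x'(f) f' = 1. Dividing by f^(n+1) and taking
  residues isolates the coefficient of X^n in x', since f' f^(k-n-1) has residue 0 unless k =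
  n.\<close>

lemma fps_lagrange_inversion:
  fixes g x :: "'a :: field_char_0 fps"
  assumes "g $ 0 \<noteq> 0" "x oo (fps_X * g) = fps_X"
  shows "of_nat (Suc n) * x $ Suc n = (inverse g ^ Suc n) $ n"
proof -
  define f where "f = fps_X * g"
  define F where "F = fps_to_fls f"
  define H where "H = inverse F"
  define p where "p = fps_deriv x"
  have [simp]: "f $ 0 = 0"
    by (simp add: f_def)
  have "f \<noteq> 0"
    using assms(1) by (auto simp: f_def)
  then have "F \<noteq> 0"
    by (simp add: F_def)
  then have FH: "F * H = 1"
    by (simp add: H_def)
  have "subdegree f = 1"
    using assms(1) by (intro subdegreeI) (auto simp: f_def)
  then have subdeg: "fls_subdegree F = 1"
    by (simp add: F_def fls_subdegree_fls_to_fps)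
  \<comment> \<open>Splitting \<open>p\<close> at degree \<open>n\<close> leaves only finitely many
    powers of \<open>f\<close> to treat; the tail is divisible by f^(n+1), and its quotient
    \<open>t\<close> is a power series, which has no residue.\<close>
  define t where "t = fps_shift (Suc n) p oo f"
  have "p = fps_X ^ Suc n * fps_shift (Suc n) p + (\<Sum>k\<le>n. fps_const (p $ k) * fps_X ^ k)"
    by (subst fps_shift_cutoff'[of "Suc n" p, symmetric])
       (auto simp: fps_eq_iff fps_sum_nth if_distrib cong: if_cong)
  then have "p oo f = (fps_X ^ Suc n * fps_shift (Suc n) p +
               (\<Sum>k\<le>n. fps_const (p $ k) * fps_X ^ k)) oo f"
    by simp
  also have "\<dots> = f ^ Suc n * t + (\<Sum>k\<le>n. fps_const (p $ k) * f ^ k)"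
    by (simp add: fps_compose_add_distrib fps_compose_mult_distrib fps_compose_sum_distrib
        fps_X_power_compose t_def del: power_Suc flip: fps_compose_power)
  finally have pf: "p oo f = f ^ Suc n * t + (\<Sum>k\<le>n. fps_const (p $ k) * f ^ k)" .
  have "1 = fps_deriv (x oo f)"
    using assms(2) by (simp add: f_def)
  also have "\<dots> = (p oo f) * fps_deriv f"
    by (simp add: fps_compose_deriv p_def)
  finally have "fps_to_fls 1 = fps_to_fls ((p oo f) * fps_deriv f)"
    by simp
  then have one: "1 = fps_to_fls (p oo f) * fls_deriv F"
    by (simp add: fls_times_fps_to_fls F_def fls_deriv_fps_to_fls)
  have sum_hom: "fps_to_fls (sum h A) = (\<Sum>i\<in>A. fps_to_fls (h i))" for h :: "nat \<Rightarrow> 'a fps" and A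
    by (induction A rule: infinite_finite_induct) auto
  have "fps_to_fls (p oo f) = F ^ Suc n * fps_to_fls t + (\<Sum>k\<le>n. fls_const (p $ k) * F ^ k)"
    unfolding pf by (simp add: sum_hom fls_times_fps_to_fls fps_to_fls_power F_def)
  then have "H ^ Suc n = (F ^ Suc n * fps_to_fls t + (\<Sum>k\<le>n. fls_const (p $ k) * F ^ k)) * fls_deriv F * H ^ Suc n"
    using one by (metis mult_1)
  also have "\<dots> = (F ^ Suc n * H ^ Suc n) * (fps_to_fls t * fls_deriv F) +
      (\<Sum>k\<le>n. fls_const (p $ k) * (fls_deriv F * (F ^ k * H ^ Suc n)))"
    by (simp add: algebra_simps sum_distrib_left sum_distrib_right del: power_Suc)
  also have "F ^ Suc n * H ^ Suc n = 1"
    by (metis FH power_mult_distrib power_one)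
  also have "(\<Sum>k\<le>n. fls_const (p $ k) * (fls_deriv F * (F ^ k * H ^ Suc n))) =
      (\<Sum>k\<le>n. fls_const (p $ k) * (fls_deriv F * H ^ Suc (n - k)))"
  proof (intro sum.cong refl)
    fix k assume "k \<in> {..n}"
    then have "Suc n = k + Suc (n - k)" by simp
    then have "F ^ k * H ^ Suc n = (F * H) ^ k * H ^ Suc (n - k)"
      by (metis mult.assoc power_add power_mult_distrib)
    then show "fls_const (p $ k) * (fls_deriv F * (F ^ k * H ^ Suc n)) =
        fls_const (p $ k) * (fls_deriv F * H ^ Suc (n - k))"
      by (simp add: FH)
  qed
  finally have eq: "H ^ Suc n = fps_to_fls (t * fps_deriv f) +
      (\<Sum>k\<le>n. fls_const (p $ k) * (fls_deriv F * H ^ Suc (n - k)))"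
    by (simp add: F_def fls_times_fps_to_fls fls_deriv_fps_to_fls)
  \<comment> \<open>For \<open>k = n\<close> this is the logarithmic derivative, whose residue is
    the order of \<open>F\<close>, here 1. For \<open>k < n\<close> the exponent is at least
    2.\<close>
  have res: "fls_residue (fls_deriv F * H ^ Suc (n - k)) = (if k = n then 1 else 0)" if "k \<le> n" for k
  proof (cases "k = n")
    case True
    then show ?thesis
      using subdeg fls_residue_deriv_times_inverse_eq_subdegree(1)[of F] by (simp add: H_def)
  next
    case False
    then show ?thesis
      using fls_residue_deriv_times_inverse_power[OF \<open>F \<noteq> 0\<close>, of "Suc (n - k)"] that
      unfolding H_def by simp
  qed
  have "(H ^ Suc n) $$ (-1) = (\<Sum>k\<le>n. p $ k * (if k = n then 1 else 0))"
    unfolding eq using res by (auto simp: fls_nth_sum simp del: power_Suc intro!: sum.cong)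
  then have "(H ^ Suc n) $$ (-1) = of_nat (Suc n) * x $ Suc n"
    by (simp add: p_def if_distrib cong: if_cong del: power_Suc)
  \<comment> \<open>Since H^(n+1) = X^(-n-1) g^(-n-1), the residue sits at index \<open>n\<close> of
    the power series g^(-n-1).\<close>
  moreover have "H = fls_X_inv * fps_to_fls (inverse g)"
    using assms(1) by (simp add: H_def F_def f_def fls_times_fps_to_fls fls_inverse_X fls_inverse_fps_to_fls)
  then have "H ^ Suc n = fls_shift (int (Suc n)) (fps_to_fls (inverse g ^ Suc n))"
    by (simp only: power_mult_distrib fls_X_inv_power_times_conv_shift fps_to_fls_power)
  then have "(H ^ Suc n) $$ (-1) = (inverse g ^ Suc n) $ n"
    by (simp del: power_Suc)
  ultimately show ?thesis
    by simp
qed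

section \<open>Convergence of Laurent series\<close>

text \<open>Distances are powers of 1/2 given by the order of the difference, so agreement below
  index \<open>m\<close> makes them at most 2^(-m). The agreement must be uniform in
  \<open>j\<close>, as infinitely many negative indices lie below \<open>m\<close>.\<close>

lemma fls_tendstoI:
  fixes s :: "'a :: group_add fls"
  assumes "\<And>m. \<forall>\<^sub>F N in sequentially. \<forall>j<m. S N $$ j = s $$ j"
  shows "S \<longlonglongrightarrow> s"
proof (rule metric_LIMSEQ_I)
  fix e :: real assume "e > 0"
  then obtain m where m: "inverse (2 ^ m) < e"
    using real_arch_pow_inv[of e "1/2"] by (auto simp: power_one_over inverse_eq_divide)
  obtain N0 where N0: "\<And>N j. N \<ge> N0 \<Longrightarrow> j < int m \<Longrightarrow> S N $$ j = s $$ j"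
    using assms[of "int m"] unfolding eventually_sequentially by blast
  have "dist (S N) s < e" if "N \<ge> N0" for N
  proof (cases "S N = s")
    case False
    then have deg: "int m \<le> fls_subdegree (S N - s)"
      using N0[OF that] by (intro fls_subdegree_geI) auto
    then have "dist (S N) s = inverse (2 ^ nat (fls_subdegree (S N - s)))"
      using False by (simp add: dist_fls_def)
    also have "\<dots> \<le> inverse (2 ^ m)"
      using deg by (intro le_imp_inverse_le power_increasing) auto
    finally show ?thesis
      using m by simp
  qed (simp add: \<open>e > 0\<close>)
  then show "\<exists>N0. \<forall>N\<ge>N0. dist (S N) s < e"
    by blast
qed

section \<open>Double factorials, binomial series and compositional inverses\<close>

text \<open>With c = -m - 1/2, raising \<open>k\<close> by one multiplies the left side by 2(m+k)+1
  and the right side by -2(c-k), which are equal.\<close>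

lemma double_fact_gchoose:
  "real (double_fact (2 * (m + k) - 1)) =
    real (double_fact (2 * m - 1)) * (-2) ^ k * fact k * ((- (2 * real m + 1) / 2) gchoose k)"
proof (induction k)
  case (Suc k)
  \<comment> \<open>At \<open>i = 0\<close> truncated subtraction yields
    \<open>double_fact 0 = 1\<close>, so the recursion includes 1!! = 1 * (-1)!!.\<close>
  have odd: "double_fact (2 * Suc i - 1) = (2 * i + 1) * double_fact (2 * i - 1)" for i
    by (cases i) auto
  define c where "c = - (2 * real m + 1) / 2"
  have gchoose: "fact (Suc k) * (c gchoose Suc k) = fact k * (c gchoose k) * (c - real k)"
    using gbinomial_mult_1[of c k] by (simp add: algebra_simps)
  have "real (double_fact (2 * (m + Suc k) - 1)) =
      (2 * real (m + k) + 1) * real (double_fact (2 * (m + k) - 1))"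
    using odd[of "m + k"] by (simp add: algebra_simps)
  also have "2 * real (m + k) + 1 = - 2 * (c - real k)"
    by (simp add: c_def field_simps)
  also have "- 2 * (c - real k) * real (double_fact (2 * (m + k) - 1)) =
      real (double_fact (2 * m - 1)) * (-2) ^ Suc k * fact (Suc k) * (c gchoose Suc k)"
    unfolding Suc.IH[folded c_def] mult.assoc gchoose by simp
  finally show ?case
    by (simp only: c_def)
qed simp

text \<open>Both sides square to 1 + u and have constant coefficient 1, and such a root is unique.
  The binomial form makes the coefficients of all powers explicit.\<close>

lemma fps_radical_eq_binomial:
  fixes u :: "real fps"
  assumes "u $ 0 = 0"
  shows "fps_radical root 2 (1 + u) = fps_binomial (1 / 2) oo u"
proof -
  have "(fps_binomial (1 / 2) oo u) ^ 2 = (fps_binomial (1 / 2) ^ 2) oo u"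
    using assms by (simp add: fps_compose_power)
  also have "\<dots> = 1 + u"
    using assms by (simp add: fps_binomial_power fps_binomial_1 fps_compose_add_distrib)
  finally show ?thesis
    using radical_unique[of root 1 "1 + u" "fps_binomial (1 / 2) oo u"] assms
    by (simp add: numeral_2_eq_2)
qed

text \<open>Exponents of binomial series add under multiplication, so the two powers multiply to the
  series with exponent 0, which is 1.\<close>

lemma fps_inverse_binomial_power_compose:
  fixes u :: "real fps"
  assumes "u $ 0 = 0"
  shows "inverse (fps_binomial c oo u) ^ n = fps_binomial (- real n * c) oo u"
proof -
  have "(fps_binomial c oo u) ^ n * (fps_binomial (- real n * c) oo u) =
      (fps_binomial (real n * c + - real n * c)) oo u"
    unfolding fps_binomial_add_mult using assms
    by (simp add: fps_compose_mult_distrib fps_binomial_power fps_compose_power)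
  then have "inverse ((fps_binomial c oo u) ^ n) = fps_binomial (- real n * c) oo u"
    by (intro fps_inverse_unique) simp
  then show ?thesis
    by (simp add: fps_inverse_power)
qed

text \<open>Composing \<open>fps_X = f oo x\<close> on the left with \<open>fps_inv f\<close> leaves
  \<open>x\<close>. The equivalence settles existence and uniqueness of the solution at
  once.\<close>

lemma fps_compositional_inverse:
  fixes f :: "'a :: field_char_0 fps"
  assumes "f $ 0 = 0" "f $ 1 \<noteq> 0"
  shows "x $ 0 = 0 \<and> fps_X = f oo x \<longleftrightarrow> x = fps_inv f"
proof
  assume x: "x $ 0 = 0 \<and> fps_X = f oo x"
  then have "fps_inv f oo fps_X = (fps_inv f oo f) oo x"
    using assms by (simp add: fps_compose_assoc[symmetric])
  then show "x = fps_inv f"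
    using assms x by (simp add: fps_inv)
qed (use fps_inv_right[OF assms] in \<open>simp add: fps_inv_def\<close>)


section \<open>Coefficients of the formal integral\<close>

text \<open>Used with \<open>d = 3\<close> to bound the order of V^k and with \<open>d = 2\<close>
  to pass between powers of V/x^2 and of V.\<close>

lemma X_power_mult_power_nth:
  fixes U :: "'a :: comm_ring_1 fps"
  shows "((fps_X ^ d * U) ^ k) $ (d * k + i) = (U ^ k) $ i"
    and "n < d * k \<Longrightarrow> ((fps_X ^ d * U) ^ k) $ n = 0"
  by (simp_all add: power_mult_distrib fps_X_power_mult_nth flip: power_mult)

text \<open>The k-th exponential term in summand \<open>n\<close> carries hbar^(n-k), so hbar^m
  collects the pairs with n = m + k. The order of V^k makes this collection finite and the partial
  sums stabilize.\<close>

lemma formal_integral_eq: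
  fixes a :: real and V S :: "real fps"
  assumes a: "a > 0" and V: "fps_X ^ 3 dvd V"
    and S: "S = - fps_const (1 / (2 * a)) * fps_X ^ 2 + V"
  shows "formal_integral S = fps_to_fls (Abs_fps (\<lambda>m. sqrt a *
    (\<Sum>k\<le>2 * m. a ^ (m + k) * real (double_fact (2 * (m + k) - 1)) * (V ^ k) $ (2 * (m + k)) / fact k)))"
proof -
  define h where "h n k = a ^ n * real (double_fact (2 * n - 1)) * (V ^ k) $ (2 * n) / fact k" for n k
  define T where "T n = (fls_const a * fls_X) ^ n * of_nat (double_fact (2 * n - 1)) *
             exp_over_hbar V $ (2 * n)" for n
  define s where "s = fps_to_fls (Abs_fps (\<lambda>m. \<Sum>k\<le>2 * m. h (m + k) k))"
  obtain U where U: "V = fps_X ^ 3 * U"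
    using V by (auto simp: dvd_def)
  have h0: "h n k = 0" if "2 * n < 3 * k" for n k
    using X_power_mult_power_nth(2)[OF that, of U] by (simp add: h_def U)
  have Tn: "T n $$ j = (\<Sum>k=0..2 * n. if j = int n - int k then h n k else 0)" for n j
  proof -
    have "T n = fls_const (a ^ n * real (double_fact (2 * n - 1))) *
       (fls_X ^ n * (\<Sum>k=0..2 * n. fls_const ((V ^ k) $ (2 * n) / fact k) * fls_X_inv ^ k))"
      unfolding T_def exp_over_hbar_nth power_mult_distrib fls_of_nat fls_const_power[symmetric]
        fls_const_mult_const[symmetric]
      by (simp only: mult_ac)
    then have "T n $$ j = a ^ n * real (double_fact (2 * n - 1)) *
       (\<Sum>k=0..2 * n. (V ^ k) $ (2 * n) / fact k * (fls_X_inv ^ k $$ (j - int n)))"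
      by (simp add: fls_X_power_times_conv_shift fls_nth_sum del: fls_X_inv_power_nth)
    then show ?thesis
      by (auto simp: h_def sum_distrib_left intro!: sum.cong)
  qed
  \<comment> \<open>A nonzero contribution needs j = n - k and 3k \<le> 2n, hence 3j = 3n - 3k \<ge>
    n.\<close>
  have T0: "T n $$ j = 0" if "3 * j < int n" for n j
    unfolding Tn using that by (intro sum.neutral) (auto intro!: h0)
  have partial: "(\<Sum>n<N. T n) $$ j = s $$ j" if N: "3 * j < int N" for j N
  proof (cases "j < 0")
    \<comment> \<open>Every summand vanishes at negative indices, so the limit is a power series in
      hbar.\<close>
    case True
    then show ?thesis
      by (auto simp: fls_nth_sum s_def T0)
  next
    case False
    then obtain m where j: "j = int m"
      by (metis nonneg_int_cases not_less)
    have "(\<Sum>n<N. T n) $$ j = (\<Sum>n<N. T n $$ j)"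
      by (simp add: fls_nth_sum)
    \<comment> \<open>For n < m no k satisfies m = n - k; for n > 3m the choice k = n - m violates
      3k \<le> 2n. The bound on \<open>N\<close> ensures that the whole interval is summed.\<close>
    also have "\<dots> = (\<Sum>n\<in>{m..m + 2 * m}. T n $$ j)"
      using N by (intro sum.mono_neutral_right)
        (auto simp: j not_le Tn intro!: sum.neutral h0)
    also have "\<dots> = (\<Sum>n\<in>{m..m + 2 * m}. h n (n - m))"
    proof (intro sum.cong refl)
      fix n assume "n \<in> {m..m + 2 * m}"
      then have "(\<Sum>k=0..2 * n. if j = int n - int k then h n k else 0) =
                 (\<Sum>k=0..2 * n. if k = n - m then h n k else 0)"
        by (intro sum.cong) (auto simp: j)
      then show "T n $$ j = h n (n - m)"
        by (simp add: Tn)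
    qed
    also have "\<dots> = (\<Sum>k\<le>2 * m. h (m + k) k)"
      by (rule sum.reindex_bij_witness[of _ "\<lambda>k. m + k" "\<lambda>n. n - m"]) auto
    finally show ?thesis
      by (simp add: s_def j)
  qed
  have "(\<lambda>N. \<Sum>n<N. T n) \<longlonglongrightarrow> s"
  proof (rule fls_tendstoI)
    fix m
    show "\<forall>\<^sub>F N in sequentially. \<forall>j<m. (\<Sum>n<N. T n) $$ j = s $$ j"
      using eventually_gt_at_top[of "nat (3 * m)"]
      by eventually_elim (auto intro!: partial)
  qed
  then have "(\<Sum>n. T n) = s"
    unfolding sums_def[symmetric] by (rule sums_unique[symmetric])
  then have "formal_integral S = fls_const (sqrt a) * s"
    unfolding S formal_integral_def Let_def quad_param_action[OF a V] interaction_action[OF a V]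
    by (simp add: T_def)
  also have "\<dots> = fps_to_fls (Abs_fps (\<lambda>m. sqrt a * (\<Sum>k\<le>2 * m. h (m + k) k)))"
    by (intro fls_eqI) (simp add: s_def)
  finally show ?thesis
    by (simp add: h_def)
qed

section \<open>Comparison with the inverse of the square root\<close>

theorem proposition2p2:
  fixes a :: real and V S :: "real fps"
  assumes "a > 0" and "fps_X ^ 3 dvd V"
    and "S = - fps_const (1 / (2 * a)) * fps_X ^ 2 + V"
  shows "(\<exists>!x. x $ 0 = 0 \<and> fps_X = pos_sqrt_action S oo x) \<and>
    (\<forall>x. x $ 0 = 0 \<and> fps_X = pos_sqrt_action S oo x \<longrightarrow>
      formal_integral S =
        fps_to_fls (Abs_fps (\<lambda>n. real (double_fact (2 * n + 1)) * x $ (2 * n + 1))))"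
proof -
  define W where "W = V / fps_X ^ 2"
  define u where "u = fps_const (- 2 * a) * W"
  define g where "g = fps_const (1 / sqrt a) * (fps_binomial (1 / 2) oo u)"
  define f where "f = pos_sqrt_action S"
  have "fps_X ^ 2 dvd V"
    using assms(2) by (rule dvd_trans[rotated]) (simp add: le_imp_power_dvd)
  then have V: "V = fps_X ^ 2 * W"
    by (simp only: W_def dvd_mult_div_cancel)
  \<comment> \<open>Vanishing of V at order 2 makes \<open>u\<close> a legitimate argument of the
    binomial series.\<close>
  have "W $ 0 = 0"
    using nth_zero_if_X_power_dvd[OF assms(2), of 2] by (simp add: V fps_X_power_mult_nth)
  then have u0: "u $ 0 = 0"
    by (simp add: u_def)
  have "1 - fps_const (2 * a) * (V / fps_X ^ 2) = 1 + u"
    unfolding u_def W_def by (simp flip: fps_const_neg)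
  then have f: "f = fps_X * g"
    unfolding f_def assms(3) pos_sqrt_action_def Let_def quad_param_action[OF assms(1,2)]
      interaction_action[OF assms(1,2)]
    by (simp only: fps_radical_eq_binomial[OF u0] g_def mult_ac)
  have g0: "g $ 0 \<noteq> 0"
    using assms(1) by (simp add: g_def)
  then have f01: "f $ 0 = 0" "f $ 1 \<noteq> 0"
    by (simp_all add: f)
  define x where "x = fps_inv f"
  have "real (double_fact (2 * m + 1)) * x $ (2 * m + 1) = sqrt a * (\<Sum>k\<le>2 * m.
      a ^ (m + k) * real (double_fact (2 * (m + k) - 1)) * (V ^ k) $ (2 * (m + k)) / fact k)" for m
  proof -
    \<comment> \<open>The exponent of 1 + u in g^(-(2m+1)), as g is a multiple of
      (1+u)^(1/2).\<close>
    define c where "c = - (2 * real m + 1) / 2"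
    have "inverse g ^ Suc (2 * m) =
        fps_const (sqrt a ^ Suc (2 * m)) * inverse (fps_binomial (1 / 2) oo u) ^ Suc (2 * m)"
      unfolding g_def fps_inverse_mult power_mult_distrib
      by (simp add: fps_const_inverse fps_const_power inverse_eq_divide del: power_Suc)
    also have "inverse (fps_binomial (1 / 2) oo u) ^ Suc (2 * m) = fps_binomial c oo u"
      unfolding fps_inverse_binomial_power_compose[OF u0] by (simp add: c_def field_simps)
    also have "sqrt a ^ Suc (2 * m) = sqrt a * a ^ m"
      using assms(1) by (simp add: power_mult)
    finally have ginv: "inverse g ^ Suc (2 * m) = fps_const (sqrt a * a ^ m) * (fps_binomial c oo u)" .
    \<comment> \<open>The factor \<open>Suc (2 * m)\<close> split off here is the one on the left of
      Lagrange inversion.\<close>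
    have df: "double_fact (2 * m + 1) = double_fact (2 * m - 1) * Suc (2 * m)"
      by (cases m) auto
    have "x oo (fps_X * g) = fps_X"
      using fps_inv[OF f01] by (simp add: x_def f)
    from fps_lagrange_inversion[OF g0 this, of "2 * m"]
    have "real (double_fact (2 * m + 1)) * x $ (2 * m + 1) =
        real (double_fact (2 * m - 1)) * (sqrt a * a ^ m * (fps_binomial c oo u) $ (2 * m))"
      unfolding df ginv by (simp only: of_nat_mult mult.assoc fps_mult_left_const_nth Suc_eq_plus1)
    also have "\<dots> = sqrt a * (\<Sum>k\<le>2 * m.
        real (double_fact (2 * m - 1)) * a ^ m * (c gchoose k) * (u ^ k) $ (2 * m))"
      by (simp add: fps_compose_nth sum_distrib_left atLeast0AtMost mult_ac)
    also have "(\<Sum>k\<le>2 * m. real (double_fact (2 * m - 1)) * a ^ m * (c gchoose k) * (u ^ k) $ (2 * m)) =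
      (\<Sum>k\<le>2 * m. a ^ (m + k) * real (double_fact (2 * (m + k) - 1)) * (V ^ k) $ (2 * (m + k)) / fact k)"
    proof (intro sum.cong refl)
      fix k
      have "(u ^ k) $ (2 * m) = (- 2 * a) ^ k * (W ^ k) $ (2 * m)"
        by (simp add: u_def power_mult_distrib fps_const_power del: mult_minus_left)
      also have "(W ^ k) $ (2 * m) = (V ^ k) $ (2 * (m + k))"
        using X_power_mult_power_nth(1)[of 2 W k "2 * m"] by (simp add: V algebra_simps)
      finally have uk: "(u ^ k) $ (2 * m) = (-2) ^ k * a ^ k * (V ^ k) $ (2 * (m + k))"
        by (simp only: power_mult_distrib)
      \<comment> \<open>The factor \<open>(-2) ^ k\<close> from u^k and the binomial coefficient
        turn (2m-1)!! into (2(m+k)-1)!! / k!.\<close>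
      show "real (double_fact (2 * m - 1)) * a ^ m * (c gchoose k) * (u ^ k) $ (2 * m) =
        a ^ (m + k) * real (double_fact (2 * (m + k) - 1)) * (V ^ k) $ (2 * (m + k)) / fact k"
        unfolding uk double_fact_gchoose c_def[symmetric] power_add by simp
    qed
    finally show ?thesis .
  qed
  then have "formal_integral S =
      fps_to_fls (Abs_fps (\<lambda>n. real (double_fact (2 * n + 1)) * x $ (2 * n + 1)))"
    unfolding formal_integral_eq[OF assms] by simp
  then show ?thesis
    unfolding f_def[symmetric] fps_compositional_inverse[OF f01] x_def by simp
qed

end
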